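(* The axiomatization consisting of A1-4, WE and TE is sound and ground-complete for BCCS($A$) modulo $\simeq_{\rm WT}$. If $|A|>1$, this axiomatization is also $\omega$-complete.
   Context: $A$ is a nonempty countable set of actions, $\tau\notin A$, $A_\tau=A\cup\{\tau\}$. BCCS($A$) terms: $t::=0\mid x\mid\alpha t\mid t+t$ ($x$ a variable, $\alpha\in A_\tau$). Transitions: $\alpha t\xrightarrow{\alpha}t$; if $t\xrightarrow{\alpha}t'$ then $t+u\xrightarrow{\alpha}t'$ and $u+t\xrightarrow{\alpha}t'$. $\Rightarrow$ is the reflexive-transitive closure of $\xrightarrow{\tau}$. $a_1\cdots a_k\in A^*$ is a weak trace of closed $s$ if $s\Rightarrow\xrightarrow{a_1}\Rightarrow\cdots\xrightarrow{a_k}\Rightarrow s'$ for some $s'$; $\mathcal{WT}(s)$ the set. $s_1\simeq_{\rm WT}s_2$ iff $\mathcal{WT}(s_1)=\mathcal{WT}(s_2)$; on open terms via all closed substitutions. Equational logic (reflexivity, symmetry, transitivity, substitution instances, closure under contexts); sound, ground-complete, $\omega$-complete (if all closed instances are derivable then the equation is). Axioms ($a$ ranges over $A$): A1: $x+y\approx y+x$; A2: $(x+y)+z\approx x+(y+z)$; A3: $x+x\approx x$; A4: $x+0\approx x$; WE: $x\approx\tau x$; TE: $ax+ay\approx a(x+y)$. *)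

theory Defs
  imports Main "HOL-Library.Countable"
begin

text \<open>The action set \<open>A\<close> is the universe of a type \<open>'a\<close>, hence nonempty; countability is imposed
  by the sort \<open>countable\<close>. The type \<open>'a act\<close> is \<open>A\<close> extended by the fresh element \<open>Tau\<close>.\<close>

datatype 'a act = Tau | Act 'a

text \<open>Variables are natural numbers (a countably infinite supply).\<close>

datatype 'a bccs =
    Zero
  | Var nat
  | Pre "'a act" "'a bccs"
  | Plus "'a bccs" "'a bccs"

primrec vars :: "'a bccs \<Rightarrow> nat set" where
  "vars Zero = {}"
| "vars (Var x) = {x}"
| "vars (Pre \<alpha> t) = vars t"
| "vars (Plus t u) = vars t \<union> vars u"

definition closed_term :: "'a bccs \<Rightarrow> bool" where
  "closed_term t \<longleftrightarrow> vars t = {}"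

primrec subst :: "(nat \<Rightarrow> 'a bccs) \<Rightarrow> 'a bccs \<Rightarrow> 'a bccs" where
  "subst \<sigma> Zero = Zero"
| "subst \<sigma> (Var x) = \<sigma> x"
| "subst \<sigma> (Pre \<alpha> t) = Pre \<alpha> (subst \<sigma> t)"
| "subst \<sigma> (Plus t u) = Plus (subst \<sigma> t) (subst \<sigma> u)"

definition closed_subst :: "(nat \<Rightarrow> 'a bccs) \<Rightarrow> bool" where
  "closed_subst \<sigma> \<longleftrightarrow> (\<forall>x. closed_term (\<sigma> x))"

inductive step :: "'a bccs \<Rightarrow> 'a act \<Rightarrow> 'a bccs \<Rightarrow> bool" where
  step_Pre: "step (Pre \<alpha> t) \<alpha> t"
| step_PlusL: "step t \<alpha> t' \<Longrightarrow> step (Plus t u) \<alpha> t'"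
| step_PlusR: "step t \<alpha> t' \<Longrightarrow> step (Plus u t) \<alpha> t'"

definition tau_steps :: "'a bccs \<Rightarrow> 'a bccs \<Rightarrow> bool" where
  "tau_steps = (\<lambda>t t'. step t Tau t')\<^sup>*\<^sup>*"

primrec weak_steps :: "'a bccs \<Rightarrow> 'a list \<Rightarrow> 'a bccs \<Rightarrow> bool" where
  "weak_steps s [] s' \<longleftrightarrow> tau_steps s s'"
| "weak_steps s (a # as) s' \<longleftrightarrow>
     (\<exists>u v. tau_steps s u \<and> step u (Act a) v \<and> weak_steps v as s')"

definition WT :: "'a bccs \<Rightarrow> 'a list set" where
  "WT s = {as. \<exists>s'. weak_steps s as s'}"

text \<open>Weak trace equivalence proper is the relation on closed terms; \<open>open_ext\<close> extends a relation
  on closed terms to open terms.\<close>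

definition wt_equiv :: "'a bccs \<Rightarrow> 'a bccs \<Rightarrow> bool" where
  "wt_equiv s t \<longleftrightarrow> WT s = WT t"

definition open_ext :: "('a bccs \<Rightarrow> 'a bccs \<Rightarrow> bool) \<Rightarrow> 'a bccs \<Rightarrow> 'a bccs \<Rightarrow> bool" where
  "open_ext R t u \<longleftrightarrow> (\<forall>\<sigma>. closed_subst \<sigma> \<longrightarrow> R (subst \<sigma> t) (subst \<sigma> u))"

inductive derivable :: "('a bccs \<times> 'a bccs) set \<Rightarrow> 'a bccs \<Rightarrow> 'a bccs \<Rightarrow> bool"
  for E :: "('a bccs \<times> 'a bccs) set" where
  derivable_axiom: "(t, u) \<in> E \<Longrightarrow> derivable E t u"
| derivable_refl: "derivable E t t"
| derivable_sym: "derivable E t u \<Longrightarrow> derivable E u t"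
| derivable_trans: "derivable E t u \<Longrightarrow> derivable E u v \<Longrightarrow> derivable E t v"
| derivable_subst: "derivable E t u \<Longrightarrow> derivable E (subst \<sigma> t) (subst \<sigma> u)"
| derivable_Pre: "derivable E t u \<Longrightarrow> derivable E (Pre \<alpha> t) (Pre \<alpha> u)"
| derivable_Plus: "derivable E t u \<Longrightarrow> derivable E t' u' \<Longrightarrow> derivable E (Plus t t') (Plus u u')"

text \<open>In the next two definitions \<open>R\<close> is a relation on closed terms.\<close>

definition sound :: "('a bccs \<times> 'a bccs) set \<Rightarrow> ('a bccs \<Rightarrow> 'a bccs \<Rightarrow> bool) \<Rightarrow> bool" where
  "sound E R \<longleftrightarrow> (\<forall>t u. derivable E t u \<longrightarrow> open_ext R t u)"

definition ground_complete :: "('a bccs \<times> 'a bccs) set \<Rightarrow> ('a bccs \<Rightarrow> 'a bccs \<Rightarrow> bool) \<Rightarrow> bool" where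
  "ground_complete E R \<longleftrightarrow>
     (\<forall>s t. closed_term s \<longrightarrow> closed_term t \<longrightarrow> R s t \<longrightarrow> derivable E s t)"

definition omega_complete :: "('a bccs \<times> 'a bccs) set \<Rightarrow> bool" where
  "omega_complete E \<longleftrightarrow>
     (\<forall>t u. (\<forall>\<sigma>. closed_subst \<sigma> \<longrightarrow> derivable E (subst \<sigma> t) (subst \<sigma> u)) \<longrightarrow> derivable E t u)"

definition A1 :: "'a bccs \<times> 'a bccs" where
  "A1 = (Plus (Var 0) (Var 1), Plus (Var 1) (Var 0))"

definition A2 :: "'a bccs \<times> 'a bccs" where
  "A2 = (Plus (Plus (Var 0) (Var 1)) (Var 2), Plus (Var 0) (Plus (Var 1) (Var 2)))"

definition A3 :: "'a bccs \<times> 'a bccs" where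
  "A3 = (Plus (Var 0) (Var 0), Var 0)"

definition A4 :: "'a bccs \<times> 'a bccs" where
  "A4 = (Plus (Var 0) Zero, Var 0)"

definition WE :: "'a bccs \<times> 'a bccs" where
  "WE = (Var 0, Pre Tau (Var 0))"

definition TE :: "'a \<Rightarrow> 'a bccs \<times> 'a bccs" where
  "TE a = (Plus (Pre (Act a) (Var 0)) (Pre (Act a) (Var 1)), Pre (Act a) (Plus (Var 0) (Var 1)))"

definition wt_axioms :: "('a bccs \<times> 'a bccs) set" where
  "wt_axioms = {A1, A2, A3, A4, WE} \<union> range TE"

end

theory Submission
  imports Defs
begin

text \<open>The equational theory proves that every term equals the sum of its weak traces (closed by \<open>0\<close>)
  and of its words leading to a variable occurrence, because \<open>TE\<close> distributes prefixes over sums and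
  \<open>WE\<close> erases \<open>\<tau>\<close>. Hence two terms with the same traces and the same variable traces are provably
  equal; closed terms have no variable traces. If there are actions \<open>a \<noteq> b\<close>, variable traces are
  recovered from closed instances by substituting \<open>a\<^sup>nb\<close> for one variable and \<open>0\<close> for the
  others: for large \<open>n\<close>, a trace ending in \<open>a\<^sup>nb\<close> must pass through that variable, and since
  \<open>a\<^sup>nb\<close> has no proper border, the variable is reached by the same word in both terms.\<close>

section \<open>Weak traces by recursion on terms\<close>

lemma step_Zero_iff [simp]: "\<not> step Zero \<alpha> t"
  by (auto elim: step.cases)

lemma step_Var_iff [simp]: "\<not> step (Var x) \<alpha> t"
  by (auto elim: step.cases)

lemma step_Pre_iff [simp]: "step (Pre \<alpha> t) \<beta> t' \<longleftrightarrow> \<beta> = \<alpha> \<and> t' = t"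
  by (auto elim: step.cases intro: step.intros)

lemma step_Plus_iff [simp]: "step (Plus t u) \<alpha> v \<longleftrightarrow> step t \<alpha> v \<or> step u \<alpha> v"
  by (auto elim: step.cases intro: step.intros)

lemma tau_steps_iff: "tau_steps s s' \<longleftrightarrow> s' = s \<or> (\<exists>v. step s Tau v \<and> tau_steps v s')"
  unfolding tau_steps_def
  by (auto elim: converse_rtranclpE intro: converse_rtranclp_into_rtranclp)

lemma Nil_in_WT [simp]: "[] \<in> WT s"
proof -
  have "weak_steps s [] s" by (simp add: tau_steps_def)
  then show ?thesis unfolding WT_def by blast
qed

text \<open>Peeling off only the first transition turns weak traces into a recursion that follows
  the syntax, from which the equations for \<open>WT\<close> below are read off.\<close>

lemma Cons_in_WT_iff:
  "a # w \<in> WT s \<longleftrightarrow>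
     (\<exists>v. step s (Act a) v \<and> w \<in> WT v) \<or> (\<exists>v. step s Tau v \<and> a # w \<in> WT v)"
proof -
  \<comment> \<open>Splitting at the first visible action leaves one closure to unfold by a single
    \<tau>-step.\<close>
  have *: "a # w \<in> WT s \<longleftrightarrow> (\<exists>u v. tau_steps s u \<and> step u (Act a) v \<and> w \<in> WT v)" for s
    unfolding WT_def mem_Collect_eq weak_steps.simps by blast
  show ?thesis
    unfolding * tau_steps_iff [of s] by blast
qed

lemma WT_Zero [simp]: "WT Zero = {[]}"
proof -
  have "w \<in> WT Zero \<longleftrightarrow> w = []" for w :: "'a list"
    using Cons_in_WT_iff [of "hd w" "tl w" Zero] by (cases w) auto
  then show ?thesis by auto
qed

lemma WT_Var [simp]: "WT (Var x) = {[]}"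
proof -
  have "w \<in> WT (Var x) \<longleftrightarrow> w = []" for w :: "'a list"
    using Cons_in_WT_iff [of "hd w" "tl w" "Var x"] by (cases w) auto
  then show ?thesis by auto
qed

lemma WT_Pre_Tau [simp]: "WT (Pre Tau t) = WT t"
proof -
  have "w \<in> WT (Pre Tau t) \<longleftrightarrow> w \<in> WT t" for w
    using Cons_in_WT_iff [of "hd w" "tl w" "Pre Tau t"] by (cases w) auto
  then show ?thesis by auto
qed

lemma WT_Pre_Act [simp]: "WT (Pre (Act a) t) = insert [] ((#) a ` WT t)"
proof -
  have "w \<in> WT (Pre (Act a) t) \<longleftrightarrow> w \<in> insert [] ((#) a ` WT t)" for w
    using Cons_in_WT_iff [of "hd w" "tl w" "Pre (Act a) t"] by (cases w) auto
  then show ?thesis by blast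
qed

lemma WT_Plus [simp]: "WT (Plus t u) = WT t \<union> WT u"
proof -
  have "w \<in> WT (Plus t u) \<longleftrightarrow> w \<in> WT t \<union> WT u" for w
  proof (cases w)
    case (Cons a v)
    then show ?thesis
      using Cons_in_WT_iff [of a v "Plus t u"] Cons_in_WT_iff [of a v t] Cons_in_WT_iff [of a v u]
      by auto
  qed simp
  then show ?thesis by blast
qed

text \<open>Variable traces: a pair \<open>(w, x)\<close> records that \<open>w\<close> leads, up to
  \<tau>-steps, to a term with \<open>x\<close> as an unguarded summand.\<close>

primrec VT :: "'a bccs \<Rightarrow> ('a list \<times> nat) set" where
  "VT Zero = {}"
| "VT (Var x) = {([], x)}"
| "VT (Pre \<alpha> t) = (case \<alpha> of Tau \<Rightarrow> VT t | Act a \<Rightarrow> (\<lambda>(w, x). (a # w, x)) ` VT t)"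
| "VT (Plus t u) = VT t \<union> VT u"

lemma closed_VT: "closed_term t \<Longrightarrow> VT t = {}"
  unfolding closed_term_def by (induction t) (auto split: act.split)

lemma VT_in_WT: "(w, x) \<in> VT t \<Longrightarrow> w \<in> WT t"
proof (induction t arbitrary: w)
  case (Pre \<alpha> t)
  then show ?case by (cases \<alpha>) auto
qed auto

text \<open>A run of the instance either stays inside \<open>t\<close> or leaves it at an occurrence
  of some \<open>x\<close>, reached along \<open>w\<close>, and continues in
  \<open>\<sigma> x\<close>. Thus \<open>WT\<close> and \<open>VT\<close> of a term determine the
  traces of all its instances.\<close>

lemma WT_subst: "WT (subst \<sigma> t) = WT t \<union> (\<Union>(w, x) \<in> VT t. (@) w ` WT (\<sigma> x))"
proof (induction t)
  case (Pre \<alpha> t)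
  then show ?case by (cases \<alpha>) (auto simp: image_Un image_UN image_image case_prod_beta)
qed auto

lemma finite_WT: "finite (WT t)"
proof (induction t)
  case (Pre \<alpha> t)
  then show ?case by (cases \<alpha>) auto
qed auto

section \<open>Soundness\<close>

lemma subst_subst: "subst \<sigma> (subst \<rho> t) = subst (\<lambda>x. subst \<sigma> (\<rho> x)) t"
  by (induction t) auto

lemma subst_Var: "subst Var t = t"
  by (induction t) auto

text \<open>Quantifying over \<sigma> inside the induction handles the substitution rule by
  composition. Since \<sigma> may be open, the choice \<open>Var\<close> compares the terms
  themselves.\<close>

lemma derivable_WT_subst:
  "derivable wt_axioms t u \<Longrightarrow> WT (subst \<sigma> t) = WT (subst \<sigma> u)"
proof (induction arbitrary: \<sigma> rule: derivable.induct)
  case (derivable_axiom t u)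
  then show ?case
    by (auto simp: wt_axioms_def A1_def A2_def A3_def A4_def WE_def TE_def)
next
  case (derivable_Pre t u \<alpha>)
  then show ?case by (cases \<alpha>) (simp_all add: derivable_Pre.IH)
next
  case (derivable_sym t u)
  show ?case by (rule derivable_sym.IH [symmetric])
next
  case (derivable_trans t u v)
  show ?case by (rule trans [OF derivable_trans.IH])
next
  case (derivable_subst t u \<rho>)
  show ?case unfolding subst_subst by (rule derivable_subst.IH)
next
  case (derivable_Plus t u t' u')
  then show ?case unfolding subst.simps WT_Plus by (intro arg_cong2 [of _ _ _ _ "(\<union>)"])
qed (rule refl)

lemma sound_wt_axioms: "sound wt_axioms wt_equiv"
  unfolding sound_def open_ext_def wt_equiv_def using derivable_WT_subst by blast

section \<open>Normal forms\<close>

abbreviation wt_eq :: "'a bccs \<Rightarrow> 'a bccs \<Rightarrow> bool" (infix \<open>\<approx>\<close> 50) where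
  "t \<approx> u \<equiv> derivable wt_axioms t u"

declare derivable_trans [trans]

definition inst3 :: "'a bccs \<Rightarrow> 'a bccs \<Rightarrow> 'a bccs \<Rightarrow> nat \<Rightarrow> 'a bccs" where
  "inst3 t u v n = (if n = 0 then t else if n = 1 then u else v)"

lemma plus_commute: "Plus t u \<approx> Plus u t"
proof -
  have "fst A1 \<approx> snd A1" by (rule derivable_axiom) (simp add: wt_axioms_def)
  from derivable_subst [OF this, of "inst3 t u u"] show ?thesis
    by (simp add: A1_def inst3_def)
qed

lemma plus_assoc: "Plus (Plus t u) v \<approx> Plus t (Plus u v)"
proof -
  have "fst A2 \<approx> snd A2" by (rule derivable_axiom) (simp add: wt_axioms_def)
  from derivable_subst [OF this, of "inst3 t u v"] show ?thesis
    by (simp add: A2_def inst3_def)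
qed

lemma plus_idem: "Plus t t \<approx> t"
proof -
  have "fst A3 \<approx> snd A3" by (rule derivable_axiom) (simp add: wt_axioms_def)
  from derivable_subst [OF this, of "inst3 t t t"] show ?thesis
    by (simp add: A3_def inst3_def)
qed

lemma plus_Zero: "Plus t Zero \<approx> t"
proof -
  have "fst A4 \<approx> snd A4" by (rule derivable_axiom) (simp add: wt_axioms_def)
  from derivable_subst [OF this, of "inst3 t t t"] show ?thesis
    by (simp add: A4_def inst3_def)
qed

lemma Pre_Tau_eq: "t \<approx> Pre Tau t"
proof -
  have "fst WE \<approx> snd WE" by (rule derivable_axiom) (simp add: wt_axioms_def)
  from derivable_subst [OF this, of "inst3 t t t"] show ?thesis
    by (simp add: WE_def inst3_def)
qed

text \<open>\<open>TE\<close> read from right to left, the direction that splits a term into single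
  words.\<close>

lemma Pre_Act_Plus: "Pre (Act a) (Plus t u) \<approx> Plus (Pre (Act a) t) (Pre (Act a) u)"
proof -
  have "fst (TE a) \<approx> snd (TE a)" by (rule derivable_axiom) (simp add: wt_axioms_def)
  from derivable_subst [OF this, of "inst3 t u u"]
  have "Plus (Pre (Act a) t) (Pre (Act a) u) \<approx> Pre (Act a) (Plus t u)"
    by (simp add: TE_def inst3_def)
  then show ?thesis by (rule derivable_sym)
qed

text \<open>The semilattice order of \<open>Plus\<close> up to provable equality. Equations then
  follow from two absorptions, and no sum over a set of words has to be built.\<close>

definition absorbs :: "'a bccs \<Rightarrow> 'a bccs \<Rightarrow> bool" where
  "absorbs t u \<longleftrightarrow> t \<approx> Plus t u"

lemma absorbs_refl: "absorbs t t"
  unfolding absorbs_def by (rule derivable_sym) (rule plus_idem)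

lemma absorbs_Zero: "absorbs t Zero"
  unfolding absorbs_def by (rule derivable_sym) (rule plus_Zero)

lemma absorbs_cong:
  assumes "absorbs t u" "t \<approx> t'" "u \<approx> u'"
  shows "absorbs t' u'"
proof -
  have "t' \<approx> t" using assms(2) by (rule derivable_sym)
  also have "t \<approx> Plus t u" using assms(1) by (simp add: absorbs_def)
  also have "Plus t u \<approx> Plus t' u'" using assms(2,3) by (rule derivable_Plus)
  finally show ?thesis by (simp add: absorbs_def)
qed

lemma absorbs_Plus:
  assumes "absorbs t u" "absorbs t v"
  shows "absorbs t (Plus u v)"
proof -
  have "t \<approx> Plus t v" using assms(2) by (simp add: absorbs_def)
  also have "Plus t v \<approx> Plus (Plus t u) v"
    using assms(1) by (auto simp: absorbs_def intro: derivable_Plus derivable_refl)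
  also have "Plus (Plus t u) v \<approx> Plus t (Plus u v)" by (rule plus_assoc)
  finally show ?thesis by (simp add: absorbs_def)
qed

lemma absorbs_PlusL:
  assumes "absorbs t v"
  shows "absorbs (Plus u t) v"
proof -
  have "Plus u t \<approx> Plus u (Plus t v)"
    using assms by (auto simp: absorbs_def intro: derivable_Plus derivable_refl)
  also have "Plus u (Plus t v) \<approx> Plus (Plus u t) v" by (rule derivable_sym) (rule plus_assoc)
  finally show ?thesis by (simp add: absorbs_def)
qed

lemma absorbs_PlusR:
  assumes "absorbs t v"
  shows "absorbs (Plus t u) v"
  using absorbs_PlusL [OF assms] plus_commute derivable_refl by (rule absorbs_cong)

lemma absorbs_Pre_Act:
  assumes "absorbs t u"
  shows "absorbs (Pre (Act a) t) (Pre (Act a) u)"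
proof -
  have "Pre (Act a) t \<approx> Pre (Act a) (Plus t u)"
    using assms by (auto simp: absorbs_def intro: derivable_Pre)
  also have "Pre (Act a) (Plus t u) \<approx> Plus (Pre (Act a) t) (Pre (Act a) u)"
    by (rule Pre_Act_Plus)
  finally show ?thesis by (simp add: absorbs_def)
qed

lemma absorbs_antisym:
  assumes "absorbs t u" "absorbs u t"
  shows "t \<approx> u"
proof -
  have "t \<approx> Plus t u" using assms(1) by (simp add: absorbs_def)
  also have "Plus t u \<approx> Plus u t" by (rule plus_commute)
  also have "Plus u t \<approx> u" using assms(2) unfolding absorbs_def by (rule derivable_sym)
  finally show ?thesis .
qed

section \<open>Words as summands\<close>

primrec word_prefix :: "'a list \<Rightarrow> 'a bccs \<Rightarrow> 'a bccs" where
  "word_prefix [] t = t"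
| "word_prefix (a # w) t = Pre (Act a) (word_prefix w t)"

lemma word_prefix_append: "word_prefix (v @ w) t = word_prefix v (word_prefix w t)"
  by (induction v) auto

lemma word_prefix_cong: "t \<approx> u \<Longrightarrow> word_prefix w t \<approx> word_prefix w u"
  by (induction w) (auto intro: derivable_Pre)

lemma word_prefix_Plus: "word_prefix w (Plus t u) \<approx> Plus (word_prefix w t) (word_prefix w u)"
proof (induction w)
  case (Cons a w)
  then have "word_prefix (a # w) (Plus t u) \<approx> Pre (Act a) (Plus (word_prefix w t) (word_prefix w u))"
    by (auto intro: derivable_Pre)
  also have "\<dots> \<approx> Plus (word_prefix (a # w) t) (word_prefix (a # w) u)"
    by (simp add: Pre_Act_Plus)
  finally show ?case .
qed (simp add: derivable_refl)

text \<open>Absorption passes through visible prefixes because \<open>TE\<close> makes them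
  distribute over sums, and through \<tau> by \<open>WE\<close>.\<close>

lemma absorbs_WT: "w \<in> WT t \<Longrightarrow> absorbs t (word_prefix w Zero)"
proof (induction t arbitrary: w)
  case (Pre \<alpha> t)
  show ?case
  proof (cases \<alpha>)
    case Tau
    with Pre have "absorbs t (word_prefix w Zero)" by simp
    then show ?thesis
      unfolding Tau using Pre_Tau_eq derivable_refl by (rule absorbs_cong)
  next
    case (Act a)
    show ?thesis
    proof (cases w)
      case Nil
      then show ?thesis by (simp add: absorbs_Zero)
    next
      case (Cons b v)
      with Act Pre.prems have "b = a" "v \<in> WT t" by auto
      with Act Cons show ?thesis by (simp add: absorbs_Pre_Act Pre.IH)
    qed
  qed
next
  case (Plus t u)
  then show ?case by (auto simp: absorbs_PlusL absorbs_PlusR)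
qed (simp_all add: absorbs_Zero)

lemma absorbs_VT: "(w, x) \<in> VT t \<Longrightarrow> absorbs t (word_prefix w (Var x))"
proof (induction t arbitrary: w)
  case (Pre \<alpha> t)
  show ?case
  proof (cases \<alpha>)
    case Tau
    with Pre have "absorbs t (word_prefix w (Var x))" by simp
    then show ?thesis
      unfolding Tau using Pre_Tau_eq derivable_refl by (rule absorbs_cong)
  next
    case (Act a)
    with Pre.prems obtain v where "w = a # v" "(v, x) \<in> VT t" by auto
    with Act show ?thesis by (simp add: absorbs_Pre_Act Pre.IH)
  qed
next
  case (Plus t u)
  then show ?case by (auto simp: absorbs_PlusL absorbs_PlusR)
qed (simp_all add: absorbs_refl)

text \<open>The word \<open>v\<close> is an accumulator for the induction on \<open>u\<close>:
  descending below an action appends it to \<open>v\<close>, and sums split by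
  \<open>word_prefix_Plus\<close>. With \<open>v\<close> empty, absorbing all words of
  \<open>u\<close> amounts to absorbing \<open>u\<close>.\<close>

lemma absorbs_word_prefixI:
  assumes "\<And>w. w \<in> WT u \<Longrightarrow> absorbs t (word_prefix (v @ w) Zero)"
    and "\<And>w x. (w, x) \<in> VT u \<Longrightarrow> absorbs t (word_prefix (v @ w) (Var x))"
  shows "absorbs t (word_prefix v u)"
  using assms
proof (induction u arbitrary: v)
  case Zero
  from Zero(1)[of "[]"] show ?case by simp
next
  case (Var x)
  from Var(2)[of "[]"] show ?case by simp
next
  case (Pre \<alpha> u)
  show ?case
  proof (cases \<alpha>)
    case Tau
    with Pre have "absorbs t (word_prefix v u)" by simp
    then show ?thesis
      unfolding Tau using derivable_refl word_prefix_cong [OF Pre_Tau_eq] by (rule absorbs_cong)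
  next
    case (Act a)
    have "absorbs t (word_prefix (v @ [a]) u)"
    proof (rule Pre.IH)
      show "absorbs t (word_prefix ((v @ [a]) @ w) Zero)" if "w \<in> WT u" for w
        using Pre.prems(1)[of "a # w"] that Act by simp
      show "absorbs t (word_prefix ((v @ [a]) @ w) (Var x))" if "(w, x) \<in> VT u" for w x
        using Pre.prems(2)[of "a # w" x] that Act by force
    qed
    then show ?thesis by (simp add: Act word_prefix_append)
  qed
next
  case (Plus u1 u2)
  then have "absorbs t (Plus (word_prefix v u1) (word_prefix v u2))"
    by (intro absorbs_Plus) auto
  then show ?case
    using derivable_refl derivable_sym [OF word_prefix_Plus] by (rule absorbs_cong)
qed

lemma absorbs_if_traces_subset:
  assumes "WT u \<subseteq> WT t" "VT u \<subseteq> VT t"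
  shows "absorbs t u"
proof -
  have "absorbs t (word_prefix [] u)"
  proof (rule absorbs_word_prefixI)
    show "absorbs t (word_prefix ([] @ w) Zero)" if "w \<in> WT u" for w
      unfolding append_Nil using that assms(1) by (intro absorbs_WT) auto
    show "absorbs t (word_prefix ([] @ w) (Var x))" if "(w, x) \<in> VT u" for w x
      unfolding append_Nil using that assms(2) by (intro absorbs_VT) auto
  qed
  then show ?thesis by simp
qed

lemma derivable_if_traces_eq:
  assumes "WT t = WT u" "VT t = VT u"
  shows "t \<approx> u"
proof (rule absorbs_antisym)
  show "absorbs t u" by (rule absorbs_if_traces_subset) (simp_all add: assms)
  show "absorbs u t" by (rule absorbs_if_traces_subset) (simp_all add: assms)
qed

lemma ground_complete_wt_axioms: "ground_complete wt_axioms wt_equiv"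
  unfolding ground_complete_def wt_equiv_def
  by (simp add: closed_VT derivable_if_traces_eq)

section \<open>Recovering variable traces from closed instances\<close>

lemma WT_word_prefix_Zero: "q \<in> WT (word_prefix p Zero) \<longleftrightarrow> (\<exists>r. p = q @ r)"
proof (induction p arbitrary: q)
  case (Cons a p)
  then show ?case by (cases q) auto
qed auto

lemma closed_word_prefix_Zero: "closed_term (word_prefix p Zero)"
  unfolding closed_term_def by (induction p) auto

text \<open>A nonempty suffix \<open>q\<close> ends in \<open>b\<close>, and \<open>b\<close> occurs
  only at the very end of the word. So a prefix ending in \<open>b\<close> is the whole word, and
  nothing is left for \<open>r\<close>.\<close>

lemma no_border:
  assumes ab: "a \<noteq> b" and is_suffix: "replicate n a @ [b] = r @ q"
    and is_prefix: "replicate n a @ [b] = q @ s" and "q \<noteq> []"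
  shows "r = []"
proof -
  from \<open>q \<noteq> []\<close> is_suffix obtain q' where q: "q = q' @ [b]"
    by (metis last_appendR last_snoc append_butlast_last_id)
  have "s = []"
  proof (rule ccontr)
    assume "s \<noteq> []"
    \<comment> \<open>Removing the final letter would leave the \<open>b\<close> of \<open>q\<close>
      among the copies of \<open>a\<close>.\<close>
    with is_prefix have "replicate n a = q @ butlast s"
      by (metis butlast_append butlast_snoc)
    then have "b \<in> set (replicate n a)" by (simp add: q)
    with ab show False by (auto split: if_splits)
  qed
  with is_suffix is_prefix show ?thesis by simp
qed

lemma VT_subset_if_instances_eq:
  fixes a b :: 'a and t u :: "'a bccs"
  assumes "a \<noteq> b"
    and eq: "\<And>\<sigma>. closed_subst \<sigma> \<Longrightarrow> WT (subst \<sigma> t) = WT (subst \<sigma> u)"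
  shows "VT t \<subseteq> VT u"
proof clarify
  fix w x
  assume wx: "(w, x) \<in> VT t"
  \<comment> \<open>The bound makes \<open>p\<close> below, of length \<open>n + 1\<close>, longer
    than every trace of \<open>u\<close>.\<close>
  obtain n where n: "\<And>v. v \<in> WT u \<Longrightarrow> length v \<le> n"
    using finite_WT [of u] by (meson finite_imageI finite_nat_set_iff_bounded_le imageI)
  define p where "p = replicate n a @ [b]"
  define \<sigma> where "\<sigma> = (\<lambda>y. if y = x then word_prefix p Zero else Zero)"
  have long: "v @ p \<notin> WT u" for v
    using n [of "v @ p"] by (auto simp: p_def)
  have "closed_subst \<sigma>"
    unfolding closed_subst_def \<sigma>_def
    using closed_word_prefix_Zero by (auto simp: closed_term_def)
  then have "WT (subst \<sigma> t) = WT (subst \<sigma> u)" by (rule eq)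
  moreover have "w @ p \<in> WT (subst \<sigma> t)"
    using wx by (force simp: WT_subst \<sigma>_def WT_word_prefix_Zero)
  ultimately have "w @ p \<in> WT (subst \<sigma> u)" by simp
  \<comment> \<open>As \<open>w @ p\<close> is too long for \<open>u\<close> itself, it must run
    through a variable of \<open>u\<close>.\<close>
  then obtain w' y q where y: "(w', y) \<in> VT u" and q: "q \<in> WT (\<sigma> y)" and eq': "w @ p = w' @ q"
    using long by (auto simp: WT_subst)
  \<comment> \<open>Otherwise \<open>w @ p\<close> would equal \<open>w'\<close>, which is a trace
    of \<open>u\<close>.\<close>
  have "q \<noteq> []"
    using VT_in_WT [OF y] long [of w] eq' by auto
  \<comment> \<open>All other variables became \<open>Zero\<close>, whose only trace is
    empty.\<close>
  with q have "y = x" by (auto simp: \<sigma>_def split: if_splits)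
  with q obtain s where s: "p = q @ s" by (auto simp: \<sigma>_def WT_word_prefix_Zero)
  \<comment> \<open>As a prefix of \<open>p\<close>, the word \<open>q\<close> is no longer than
    \<open>p\<close>; hence it is also a suffix of \<open>p\<close>, and \<open>no_border\<close>
    applies.\<close>
  have "length w \<le> length w'"
    using arg_cong [OF eq', of length] arg_cong [OF s, of length] by simp
  with eq' obtain r where r: "w' = w @ r" "p = r @ q"
    by (auto simp: append_eq_append_conv2)
  have "r = []"
    using no_border [OF \<open>a \<noteq> b\<close>] r(2) s \<open>q \<noteq> []\<close> unfolding p_def by metis
  with r y \<open>y = x\<close> show "(w, x) \<in> VT u" by simp
qed

lemma WT_eq_if_instances_eq:
  fixes t u :: "'a bccs"
  assumes "\<And>\<sigma>. closed_subst \<sigma> \<Longrightarrow> WT (subst \<sigma> t) = WT (subst \<sigma> u)"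
  shows "WT t = WT u"
proof -
  \<comment> \<open>The only words contributed by variables are those reaching them, which are
    traces of \<open>v\<close> already by \<open>VT_in_WT\<close>.\<close>
  have "WT (subst (\<lambda>_. Zero) v) = WT v" for v :: "'a bccs"
    using VT_in_WT by (fastforce simp: WT_subst)
  moreover have "closed_subst (\<lambda>_. Zero)"
    by (simp add: closed_subst_def closed_term_def)
  ultimately show ?thesis using assms by metis
qed

lemma omega_complete_wt_axioms:
  fixes a b :: 'a
  assumes "a \<noteq> b"
  shows "omega_complete (wt_axioms :: ('a bccs \<times> 'a bccs) set)"
  unfolding omega_complete_def
proof (intro allI impI)
  fix t u :: "'a bccs"
  assume der: "\<forall>\<sigma>. closed_subst \<sigma> \<longrightarrow> subst \<sigma> t \<approx> subst \<sigma> u"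
  have eq: "WT (subst \<sigma> t) = WT (subst \<sigma> u)" if "closed_subst \<sigma>" for \<sigma>
  proof -
    from der that have "subst \<sigma> t \<approx> subst \<sigma> u" by simp
    \<comment> \<open>The identity substitution turns the derivation into an equality of the traces
      of the two instances.\<close>
    from derivable_WT_subst [OF this, of Var] show ?thesis by (simp add: subst_Var)
  qed
  show "t \<approx> u"
  proof (rule derivable_if_traces_eq)
    show "WT t = WT u" by (rule WT_eq_if_instances_eq) (rule eq)
    have "VT t \<subseteq> VT u" by (rule VT_subset_if_instances_eq [OF assms]) (rule eq)
    moreover have "VT u \<subseteq> VT t"
      by (rule VT_subset_if_instances_eq [OF assms]) (rule eq [symmetric])
    ultimately show "VT t = VT u" by (rule equalityI)
  qed
qed

theorem theorem4p5:
  shows "sound (wt_axioms :: ('a::countable bccs \<times> 'a bccs) set) wt_equiv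
       \<and> ground_complete (wt_axioms :: ('a bccs \<times> 'a bccs) set) wt_equiv
       \<and> ((\<exists>a b :: 'a. a \<noteq> b) \<longrightarrow> omega_complete (wt_axioms :: ('a bccs \<times> 'a bccs) set))"
proof (intro conjI impI)
  show "omega_complete (wt_axioms :: ('a bccs \<times> 'a bccs) set)" if "\<exists>a b :: 'a. a \<noteq> b"
    using that by (elim exE) (rule omega_complete_wt_axioms)
qed (rule sound_wt_axioms ground_complete_wt_axioms)+

end
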